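(* Let $N\ge 2$ be an integer. Let $f:\mathbb{R}\to\mathbb{R}$ be continuous and strictly increasing with $f(0)=0$ and $\liminf_{t\to 0}\frac{f(t)}{t}>0$. Let $F(t)=\int_0^t f(s)\,ds$, and assume that there exist $\theta_0>1$ and $T>0$ such that $t f(t)\ge \theta_0 F(t)$ for all $|t|\ge T$. Let $g:\mathbb{R}\to\mathbb{R}$ be continuous and satisfy $$g^2(t)\neq 2F(t)\ \text{ for all } t\in\mathbb{R},\qquad\text{and}\qquad \lim_{|t|\to\infty}\frac{g^2(t)}{2F(t)}\neq 1.$$ Then there exists $R^*=R^*(f,g)>0$, depending on $f$ and $g$, such that for every $R>R^*$ the boundary value problem $$-u''(r)-\frac{N-1}{r}u'(r)+f(u(r))=0,\quad r\in(0,R),\qquad u'(0)=0,\quad u'(R)=g(u(R)),$$ has no solution.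
   Context: A solution means a classical real-valued solution: $u\in C^2((0,R))\cap C^1([0,R])$ satisfying the differential equation pointwise on $(0,R)$ and both boundary conditions. Here $g^2(t)=(g(t))^2$. The condition on $\lim_{|t|\to\infty}\frac{g^2(t)}{2F(t)}$ means that this limit exists in $[0,\infty]$ and is different from $1$. *)

theory Defs
  imports "HOL-Analysis.Analysis"
begin

text \<open>Interval integrals are oriented: for \<open>t < 0\<close> this is minus the integral over \<open>[t, 0]\<close>.\<close>

definition primitive :: "(real \<Rightarrow> real) \<Rightarrow> real \<Rightarrow> real" where
  "primitive f t = (LBINT s=ereal 0..ereal t. f s)"

text \<open>Classical solutions in \<open>C\<^sup>2((0,R)) \<inter> C\<^sup>1([0,R])\<close>; \<open>u'\<close> and \<open>u''\<close> are the derivatives of \<open>u\<close>,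
  with \<open>u'\<close> one-sided at the end points. The values of \<open>u\<close> outside \<open>[0,R]\<close> play no role.\<close>

definition is_classical_solution ::
    "nat \<Rightarrow> (real \<Rightarrow> real) \<Rightarrow> (real \<Rightarrow> real) \<Rightarrow> real \<Rightarrow> (real \<Rightarrow> real) \<Rightarrow> bool" where
  "is_classical_solution N f g R u \<longleftrightarrow>
    (\<exists>u' u''.
      (\<forall>r\<in>{0..R}. (u has_real_derivative u' r) (at r within {0..R})) \<and>
      continuous_on {0..R} u' \<and>
      (\<forall>r\<in>{0<..<R}. (u' has_real_derivative u'' r) (at r)) \<and>
      continuous_on {0<..<R} u'' \<and>
      (\<forall>r\<in>{0<..<R}. - u'' r - (real N - 1) / r * u' r + f (u r) = 0) \<and>
      u' 0 = 0 \<and> u' R = g (u R))"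

end

theory Submission
  imports Defs
begin

text \<open>Because \<open>F(0) = 0\<close>, the condition \<open>g\<^sup>2 \<noteq> 2F\<close> at \<open>0\<close> gives \<open>g(0)\<^sup>2 > 0\<close>, hence \<open>g\<^sup>2 > 2F\<close> everywhere
  by the intermediate value theorem. On the other hand the energy \<open>u'\<^sup>2/2 - F(u)\<close> of a solution has
  derivative \<open>- (N - 1) u'\<^sup>2 / r \<le> 0\<close> and starts at \<open>- F(u(0)) \<le> 0\<close>, so \<open>g(u(R))\<^sup>2 \<le> 2F(u(R))\<close>.
  Thus no \<open>R > 0\<close> admits a solution.\<close>

lemma primitive_zero: "primitive f 0 = 0"
  by (simp add: primitive_def)

lemma primitive_has_real_derivative:
  assumes "continuous_on UNIV f"
  shows "(primitive f has_real_derivative f x) (at x)"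
proof -
  \<comment> \<open>The margins of 1 put both 0, the base point of the integral, and
    \<open>x\<close> in the interior of \<open>{a..b}\<close>. The fundamental theorem yields a
    derivative within \<open>{a..b}\<close>, which at an interior point is the full
    derivative.\<close>
  define a b where "a = min 0 x - 1" and "b = max 0 x + 1"
  have "((\<lambda>t. LBINT s=ereal 0..ereal t. f s) has_vector_derivative f x) (at x within {a..b})"
    by (rule interval_integral_FTC2)
      (auto simp: a_def b_def intro: continuous_on_subset[OF assms])
  moreover have "at x within {a..b} = at x"
    by (rule at_within_Icc_at) (auto simp: a_def b_def)
  ultimately show ?thesis
    by (simp add: has_real_derivative_iff_has_vector_derivative primitive_def[abs_def])
qed

text \<open>By monotonicity \<open>f\<close> is nonpositive left of 0 and nonnegative right of 0, so
  \<open>primitive f\<close> falls to its value 0 at the origin and rises afterwards.\<close>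

lemma primitive_nonneg:
  assumes "continuous_on UNIV f" "mono f" "f 0 = 0"
  shows "0 \<le> primitive f t"
proof (cases "t \<ge> 0")
  case True
  have "primitive f 0 \<le> primitive f t"
  proof (rule DERIV_nonneg_imp_nondecreasing[OF True])
    fix x :: real assume "0 \<le> x"
    then have "0 \<le> f x" using monoD[OF \<open>mono f\<close>, of 0 x] \<open>f 0 = 0\<close> by simp
    then show "\<exists>y. (primitive f has_real_derivative y) (at x) \<and> 0 \<le> y"
      using primitive_has_real_derivative[OF assms(1)] by blast
  qed
  then show ?thesis by (simp add: primitive_zero)
next
  case False
  then have "t \<le> 0" by simp
  then have "primitive f 0 \<le> primitive f t"
  proof (rule DERIV_nonpos_imp_nonincreasing)
    fix x :: real assume "x \<le> 0"
    then have "f x \<le> 0" using monoD[OF \<open>mono f\<close>, of x 0] \<open>f 0 = 0\<close> by simp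
    then show "\<exists>y. (primitive f has_real_derivative y) (at x) \<and> y \<le> 0"
      using primitive_has_real_derivative[OF assms(1)] by blast
  qed
  then show ?thesis by (simp add: primitive_zero)
qed

lemma classical_solution_boundary_bound:
  assumes f: "continuous_on UNIV f" "mono f" "f 0 = 0"
    and "N \<ge> 1" "R > 0" and sol: "is_classical_solution N f g R u"
  shows "(g (u R))\<^sup>2 \<le> 2 * primitive f (u R)"
proof -
  obtain u' u'' where
    du: "\<And>r. r \<in> {0..R} \<Longrightarrow> (u has_real_derivative u' r) (at r within {0..R})" and
    cu': "continuous_on {0..R} u'" and
    du': "\<And>r. r \<in> {0<..<R} \<Longrightarrow> (u' has_real_derivative u'' r) (at r)" and
    ode: "\<And>r. r \<in> {0<..<R} \<Longrightarrow> - u'' r - (real N - 1) / r * u' r + f (u r) = 0" and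
    bc: "u' 0 = 0" "u' R = g (u R)"
    using sol unfolding is_classical_solution_def by blast
  define E where "E r = (u' r)\<^sup>2 / 2 - primitive f (u r)" for r
  \<comment> \<open>The chain rule is applied within \<open>{0..R}\<close>, so that the one-sided
    derivatives of \<open>u\<close> also give continuity at both end points.\<close>
  have "continuous_on {0..R} (\<lambda>r. primitive f (u r))"
    by (rule DERIV_continuous_on[OF DERIV_chain2[OF
          primitive_has_real_derivative[OF f(1)] du]])
  then have contE: "continuous_on {0..R} E"
    unfolding E_def using cu' by (intro continuous_intros) auto
  have "\<exists>y. (E has_real_derivative y) (at r) \<and> y \<le> 0" if "0 < r" "r < R" for r
  proof -
    have "(u has_real_derivative u' r) (at r)"
      using du[of r] that by (simp add: at_within_Icc_at)
    then have "((\<lambda>r. primitive f (u r)) has_real_derivative f (u r) * u' r) (at r)"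
      by (rule DERIV_chain2[OF primitive_has_real_derivative[OF f(1)]])
    then have dE: "(E has_real_derivative u' r * u'' r - f (u r) * u' r) (at r)"
      unfolding E_def using that by (auto intro!: derivative_eq_intros du')
    \<comment> \<open>Multiplying the equation by \<open>u' r\<close> cancels
      \<open>u' r * u'' r\<close> and leaves only the friction term.\<close>
    have "f (u r) = u'' r + (real N - 1) / r * u' r"
      using ode[of r] that by simp
    then have "u' r * u'' r - f (u r) * u' r = - ((real N - 1) / r * (u' r)\<^sup>2)"
      by (simp add: algebra_simps power2_eq_square)
    also have "\<dots> \<le> 0"
      using that \<open>N \<ge> 1\<close> by simp
    finally have "u' r * u'' r - f (u r) * u' r \<le> 0" .
    with dE show ?thesis by blast
  qed
  \<comment> \<open>The equation holds only on the open interval and its coefficient is singular at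
    0; continuity of \<open>E\<close> carries the monotonicity to the end points.\<close>
  then have "E R \<le> E 0"
    by (rule DERIV_nonpos_imp_decreasing_open[OF less_imp_le[OF \<open>R > 0\<close>] _ contE])
  also have "E 0 \<le> 0"
    by (simp add: E_def bc primitive_nonneg[OF f])
  finally show ?thesis
    by (simp add: E_def bc)
qed

lemma boundary_nonlinearity_dominates:
  assumes "continuous_on UNIV f" "continuous_on UNIV g"
    and ne: "\<And>t. (g t)\<^sup>2 \<noteq> 2 * primitive f t"
  shows "2 * primitive f t < (g t)\<^sup>2"
proof (rule ccontr)
  define h where "h t = (g t)\<^sup>2 - 2 * primitive f t" for t
  assume "\<not> ?thesis"
  then have "h t \<le> 0" by (simp add: h_def)
  \<comment> \<open>The primitive vanishes at 0, so \<open>h 0\<close> is a square. Since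
    \<open>h t\<close> is at most 0, the connected range of \<open>h\<close> must contain 0, against
    \<open>ne\<close>.\<close>
  moreover have "0 \<le> h 0" by (simp add: h_def primitive_zero)
  moreover have "continuous_on UNIV (primitive f)"
    by (rule DERIV_continuous_on[OF has_field_derivative_at_within[OF
          primitive_has_real_derivative[OF assms(1)]]])
  then have "continuous_on UNIV h"
    unfolding h_def using assms(2) by (intro continuous_intros)
  then have "connected (range h)"
    by (rule connected_continuous_image) simp
  ultimately have "0 \<in> range h"
    using connectedD_interval[of "range h" "h t" "h 0" 0] by blast
  then show False using ne by (auto simp: h_def)
qed

theorem theorem1p1:
  fixes N :: nat and f g :: "real \<Rightarrow> real"
  assumes "N \<ge> 2"
    and "continuous_on UNIV f" and "strict_mono f" and "f 0 = 0"
    and "Liminf (at 0) (\<lambda>t. ereal (f t / t)) > 0"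
    and "\<exists>\<theta>\<^sub>0 T. \<theta>\<^sub>0 > 1 \<and> T > 0 \<and> (\<forall>t. \<bar>t\<bar> \<ge> T \<longrightarrow> t * f t \<ge> \<theta>\<^sub>0 * primitive f t)"
    and "continuous_on UNIV g"
    and "\<forall>t. (g t)\<^sup>2 \<noteq> 2 * primitive f t"
    and "\<exists>L::ereal. 0 \<le> L \<and> L \<noteq> 1 \<and>
           ((\<lambda>t. ereal ((g t)\<^sup>2 / (2 * primitive f t))) \<longlongrightarrow> L) at_infinity"
  shows "\<exists>Rstar>0. \<forall>R>Rstar. \<not> (\<exists>u. is_classical_solution N f g R u)"
\<comment> \<open>The witness 1 is an arbitrary positive number: the two bounds on
  \<open>g (u R)\<close> clash for every positive \<open>R\<close>.\<close>
proof (intro exI[of _ 1] conjI allI impI notI)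
  fix R :: real
  assume "R > 1" and "\<exists>u. is_classical_solution N f g R u"
  then obtain u where "is_classical_solution N f g R u" by blast
  then have "(g (u R))\<^sup>2 \<le> 2 * primitive f (u R)"
    using assms(1-4) \<open>R > 1\<close>
    by (intro classical_solution_boundary_bound[of f N R g u]) (auto intro: strict_mono_mono)
  moreover have "2 * primitive f (u R) < (g (u R))\<^sup>2"
    using assms(2,7,8) by (intro boundary_nonlinearity_dominates) auto
  ultimately show False by simp
qed simp

end
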